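(* Let $n$ be a positive integer and let $A=(A_{ij})$ be an $n\times n$ matrix. Then $$\sum_{\mathbf r\in\mathbb{Z}_{\ge0}^n}\frac{1}{\mathbf r!}\,\mathrm{dperm}_{\beta}\,A(n^{\mathbf r},n^{\mathbf r})=\frac{e^{-\beta\,\mathrm{Tr}A}}{\det(I-A)^{\beta}}.$$
   Context: Extended deranged permanent: for a square matrix $M=(M_{xy})$ indexed by a finite set $X$, $\mathrm{dperm}_\beta M=\sum_{\pi}\beta^{C(\pi)}\prod_{x\in X}M_{x\pi(x)}$, where the sum is over all derangements $\pi$ of $X$ (permutations of $X$ with no fixed points, i.e. no cycles of length 1) and $C(\pi)$ is the number of cycles of $\pi$. For $X=\emptyset$ the value is $1$. Multisets: for $\mathbf r=(r_1,\ldots,r_n)\in\mathbb{Z}_{\ge0}^n$ put $\mathbf r!=r_1!\cdots r_n!$, $N=r_1+\cdots+r_n$, and let $n^{\mathbf r}=\{1_1,\ldots,1_{r_1},\ldots,n_1,\ldots,n_{r_n}\}$ be the multiset of size $N$ in which the index $i$ is repeated $r_i$ times; the labelled copies $i_a$ ($1\le a\le r_i$) are treated as $N$ distinct indices (so a derangement may send $i_a$ to $i_b$ with $a\ne b$). $A(n^{\mathbf r},n^{\mathbf r})$ is the $N\times N$ matrix indexed by $n^{\mathbf r}$ with $(i_a,j_b)$ entry $A_{ij}$. Interpretation: $\beta$ and the entries of $A$ are commuting indeterminates and the identity is one of formal power series with rational coefficients in them; $\det(I-A)^{-\beta}$ means $\exp\left(\beta\sum_{t\ge1}\frac1t\mathrm{Tr}(A^t)\right)$.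 $I$ is the identity matrix. *)

theory Defs
  imports "HOL-Analysis.Analysis" "HOL-Library.Poly_Mapping" "HOL-Combinatorics.Orbits"
begin

section \<open>Multivariate formal power series\<close>

text \<open>Monomials in indeterminates from \<open>'v\<close> are exponent vectors of finite support; a power series
  is an arbitrary assignment of coefficients to monomials.\<close>

typedef (overloaded) ('v, 'a) mfps = "UNIV :: (('v \<Rightarrow>\<^sub>0 nat) \<Rightarrow> 'a::zero) set"
  morphisms mfps_coeff Abs_mfps ..

lemma mfps_coeff_Abs [simp]: "mfps_coeff (Abs_mfps f) = f"
  by (simp add: Abs_mfps_inverse)

lemma mfps_eqI: "(\<And>m. mfps_coeff f m = mfps_coeff g m) \<Longrightarrow> f = g"
  by (metis ext mfps_coeff_inject)

lemma mfps_eq_iff: "f = g \<longleftrightarrow> (\<forall>m. mfps_coeff f m = mfps_coeff g m)"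
  by (auto intro: mfps_eqI)

definition splits :: "('v \<Rightarrow>\<^sub>0 nat) \<Rightarrow> (('v \<Rightarrow>\<^sub>0 nat) \<times> ('v \<Rightarrow>\<^sub>0 nat)) set" where
  "splits m = {(a, b). a + b = m}"

lemma finite_splits [simp]: "finite (splits m)"
proof -
  let ?L = "{a. \<exists>b. a + b = m}"
  let ?B = "{..Max (insert 0 (Poly_Mapping.lookup m ` Poly_Mapping.keys m))}"
  let ?F = "{f. \<forall>x. (x \<in> Poly_Mapping.keys m \<longrightarrow> f x \<in> ?B) \<and> (x \<notin> Poly_Mapping.keys m \<longrightarrow> f x = 0)}"
  have "finite ?F"
    by (rule finite_set_of_finite_funs) auto
  moreover have "Poly_Mapping.lookup ` ?L \<subseteq> ?F"
  proof clarify
    fix a b :: "'a \<Rightarrow>\<^sub>0 nat" and x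
    assume m: "m = a + b"
    have le: "Poly_Mapping.lookup a x \<le> Poly_Mapping.lookup (a + b) x"
      by (simp add: lookup_add)
    have "Poly_Mapping.lookup a x
        \<le> Max (insert 0 (Poly_Mapping.lookup (a + b) ` Poly_Mapping.keys (a + b)))"
      if "x \<in> Poly_Mapping.keys (a + b)"
      using that by (intro order.trans[OF le] Max_ge) auto
    moreover have "Poly_Mapping.lookup a x = 0" if "x \<notin> Poly_Mapping.keys (a + b)"
      using that le by (simp add: in_keys_iff)
    ultimately show "(x \<in> Poly_Mapping.keys (a + b) \<longrightarrow> Poly_Mapping.lookup a x \<in>
        {..Max (insert 0 (Poly_Mapping.lookup (a + b) ` Poly_Mapping.keys (a + b)))}) \<and>
        (x \<notin> Poly_Mapping.keys (a + b) \<longrightarrow> Poly_Mapping.lookup a x = 0)"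
      by auto
  qed
  ultimately have "finite (Poly_Mapping.lookup ` ?L)"
    by (rule rev_finite_subset)
  then have L: "finite ?L"
    by (rule finite_imageD) (auto simp: inj_on_def intro: poly_mapping_eqI)
  have "splits m \<subseteq> (\<lambda>a. (a, m - a)) ` ?L"
    by (auto simp: splits_def image_iff)
  then show ?thesis
    using L by (meson finite_imageI finite_subset)
qed

instantiation mfps :: (type, comm_ring_1) comm_ring_1
begin

definition zero_mfps_def: "0 = Abs_mfps (\<lambda>_. 0)"
definition one_mfps_def: "1 = Abs_mfps (\<lambda>m. if m = 0 then 1 else 0)"
definition plus_mfps_def: "f + g = Abs_mfps (\<lambda>m. mfps_coeff f m + mfps_coeff g m)"
definition uminus_mfps_def: "- f = Abs_mfps (\<lambda>m. - mfps_coeff f m)"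
definition minus_mfps_def: "f - g = Abs_mfps (\<lambda>m. mfps_coeff f m - mfps_coeff g m)"
definition times_mfps_def:
  "f * g = Abs_mfps (\<lambda>m. \<Sum>(a, b)\<in>splits m. mfps_coeff f a * mfps_coeff g b)"

instance
proof
  fix f g h :: "('a, 'b) mfps"
  show "f * g * h = f * (g * h)"
  proof (rule mfps_eqI)
    fix m
    have "mfps_coeff (f * g * h) m = (\<Sum>(p, c)\<in>splits m. \<Sum>(a, b)\<in>splits p.
        mfps_coeff f a * mfps_coeff g b * mfps_coeff h c)"
      by (simp add: times_mfps_def sum_distrib_right case_prod_unfold)
    also have "\<dots> = (\<Sum>((p, c), (a, b))\<in>(SIGMA (p, c):splits m. splits p).
        mfps_coeff f a * mfps_coeff g b * mfps_coeff h c)"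
      by (subst sum.Sigma[symmetric]) (auto simp: case_prod_unfold)
    also have "\<dots> = (\<Sum>((a, q), (b, c))\<in>(SIGMA (a, q):splits m. splits q).
        mfps_coeff f a * mfps_coeff g b * mfps_coeff h c)"
      by (rule sum.reindex_bij_witness[of _
            "\<lambda>((a, q), (b, c)). ((a + b, c), (a, b))"
            "\<lambda>((p, c), (a, b)). ((a, b + c), (b, c))"])
         (auto simp: splits_def add.assoc)
    also have "\<dots> = (\<Sum>(a, q)\<in>splits m. \<Sum>(b, c)\<in>splits q.
        mfps_coeff f a * mfps_coeff g b * mfps_coeff h c)"
      by (subst sum.Sigma[symmetric]) (auto simp: case_prod_unfold)
    also have "\<dots> = mfps_coeff (f * (g * h)) m"
      by (simp add: times_mfps_def sum_distrib_left case_prod_unfold mult.assoc)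
    finally show "mfps_coeff (f * g * h) m = mfps_coeff (f * (g * h)) m" .
  qed
  show "f * g = g * f"
  proof (rule mfps_eqI)
    fix m
    show "mfps_coeff (f * g) m = mfps_coeff (g * f) m"
      unfolding times_mfps_def mfps_coeff_Abs
      by (rule sum.reindex_bij_witness[of _ prod.swap prod.swap])
         (auto simp: splits_def add.commute mult.commute)
  qed
  show "1 * f = f"
  proof (rule mfps_eqI)
    fix m
    have "mfps_coeff (1 * f) m = (\<Sum>x\<in>splits m. if x = (0, m) then mfps_coeff f m else 0)"
      unfolding times_mfps_def one_mfps_def mfps_coeff_Abs
      by (rule sum.cong) (auto simp: splits_def split: if_splits)
    moreover have "(0, m) \<in> splits m"
      by (simp add: splits_def)
    ultimately show "mfps_coeff (1 * f) m = mfps_coeff f m"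
      by simp
  qed
  show "(f + g) * h = f * h + g * h"
    by (rule mfps_eqI)
       (simp add: times_mfps_def plus_mfps_def distrib_right sum.distrib case_prod_unfold)
  show "(0 :: ('a, 'b) mfps) \<noteq> 1"
    by (auto simp: mfps_eq_iff zero_mfps_def one_mfps_def)
qed (rule mfps_eqI; simp add: plus_mfps_def zero_mfps_def uminus_mfps_def minus_mfps_def
       add_ac)+

end

lemma mfps_coeff_0 [simp]: "mfps_coeff 0 m = 0"
  and mfps_coeff_1: "mfps_coeff 1 m = (if m = 0 then 1 else 0)"
  and mfps_coeff_add [simp]: "mfps_coeff (f + g) m = mfps_coeff f m + mfps_coeff g m"
  and mfps_coeff_uminus [simp]: "mfps_coeff (- f) m = - mfps_coeff f m"
  and mfps_coeff_diff [simp]: "mfps_coeff (f - g) m = mfps_coeff f m - mfps_coeff g m"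
  and mfps_coeff_mult:
    "mfps_coeff (f * g) m = (\<Sum>(a, b)\<in>splits m. mfps_coeff f a * mfps_coeff g b)"
  by (simp_all add: zero_mfps_def one_mfps_def plus_mfps_def uminus_mfps_def minus_mfps_def
        times_mfps_def)

lemma mfps_coeff_sum [simp]: "mfps_coeff (sum F S) m = (\<Sum>x\<in>S. mfps_coeff (F x) m)"
  by (induction S rule: infinite_finite_induct) auto

definition mfps_const :: "'a \<Rightarrow> ('v, 'a::comm_ring_1) mfps" where
  "mfps_const c = Abs_mfps (\<lambda>m. if m = 0 then c else 0)"

definition mfps_var :: "'v \<Rightarrow> ('v, 'a::comm_ring_1) mfps" where
  "mfps_var v = Abs_mfps (\<lambda>m. if m = Poly_Mapping.single v 1 then 1 else 0)"

lemma mfps_coeff_const_mult [simp]: "mfps_coeff (mfps_const c * f) m = c * mfps_coeff f m"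
proof -
  have "mfps_coeff (mfps_const c * f) m
      = (\<Sum>x\<in>splits m. if x = (0, m) then c * mfps_coeff f m else 0)"
    unfolding mfps_coeff_mult mfps_const_def mfps_coeff_Abs
    by (rule sum.cong) (auto simp: splits_def split: if_splits)
  moreover have "(0, m) \<in> splits m"
    by (simp add: splits_def)
  ultimately show ?thesis
    by simp
qed


subsection \<open>Infinite formal sums\<close>

text \<open>A family of power series is summable if each monomial occurs in only finitely many members
  (convergence in the product of the discrete topologies); sums are then taken coefficientwise.
  Off summable families the value of \<open>formal_sum\<close> carries no meaning; the two uses of it below,
  in \<open>mfps_exp\<close> and in \<open>det_I_minus_powr_uminus\<close>, are shown to be summable for series, resp.\
  matrices of series, without constant term.\<close>

definition formally_summable :: "('i \<Rightarrow> ('v, 'a::comm_ring_1) mfps) \<Rightarrow> 'i set \<Rightarrow> bool" where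
  "formally_summable F S \<longleftrightarrow> (\<forall>m. finite {x\<in>S. mfps_coeff (F x) m \<noteq> 0})"

definition formal_sum :: "('i \<Rightarrow> ('v, 'a::comm_ring_1) mfps) \<Rightarrow> 'i set \<Rightarrow> ('v, 'a) mfps" where
  "formal_sum F S =
     Abs_mfps (\<lambda>m. \<Sum>x | x \<in> S \<and> mfps_coeff (F x) m \<noteq> 0. mfps_coeff (F x) m)"

definition has_formal_sum ::
    "('i \<Rightarrow> ('v, 'a::comm_ring_1) mfps) \<Rightarrow> ('v, 'a) mfps \<Rightarrow> 'i set \<Rightarrow> bool" where
  "has_formal_sum F s S \<longleftrightarrow> formally_summable F S \<and> formal_sum F S = s"

definition mfps_exp :: "('v, 'a::field_char_0) mfps \<Rightarrow> ('v, 'a) mfps" where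
  "mfps_exp f = formal_sum (\<lambda>k. mfps_const (1 / fact k) * f ^ k) UNIV"


section \<open>Powers of a determinant\<close>

primrec matpow :: "'a::semiring_1 ^ 'n ^ 'n \<Rightarrow> nat \<Rightarrow> 'a ^ 'n ^ 'n" where
  "matpow A 0 = mat 1"
| "matpow A (Suc t) = A ** matpow A t"

text \<open>\<open>det (I - A)\<close> raised to the power \<open>-\<beta>\<close>, where \<open>\<beta>\<close> is itself a series: the formal meaning is
  \<open>exp (\<beta> * (\<Sum>t\<ge>1. Tr (A\<^sup>t) / t))\<close>.\<close>

definition det_I_minus_powr_uminus ::
    "('v, 'a::field_char_0) mfps ^ 'n ^ 'n \<Rightarrow> ('v, 'a) mfps \<Rightarrow> ('v, 'a) mfps" where
  "det_I_minus_powr_uminus A \<beta> =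
     mfps_exp (\<beta> * formal_sum (\<lambda>t. mfps_const (1 / of_nat t) * trace (matpow A t)) {1..})"


subsection \<open>Summability of the series used\<close>

definition monom_deg :: "('v \<Rightarrow>\<^sub>0 nat) \<Rightarrow> nat" where
  "monom_deg m = (\<Sum>v\<in>Poly_Mapping.keys m. Poly_Mapping.lookup m v)"

lemma monom_deg_add: "monom_deg (a + b) = monom_deg a + monom_deg b"
  unfolding monom_deg_def
  by (rule setsum_keys_plus_distrib) auto

lemma monom_deg_eq_0 [simp]: "monom_deg m = 0 \<longleftrightarrow> m = 0"
  by (auto simp: monom_deg_def in_keys_iff intro: poly_mapping_eqI)

definition order_ge :: "nat \<Rightarrow> ('v, 'a::comm_ring_1) mfps \<Rightarrow> bool" where
  "order_ge k f \<longleftrightarrow> (\<forall>m. monom_deg m < k \<longrightarrow> mfps_coeff f m = 0)"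

lemma order_ge_0 [simp]: "order_ge 0 f"
  by (simp add: order_ge_def)

lemma order_ge_1_iff: "order_ge 1 f \<longleftrightarrow> mfps_coeff f 0 = 0"
  by (auto simp: order_ge_def)

lemma order_ge_mult:
  fixes f g :: "('v, 'a::comm_ring_1) mfps"
  assumes "order_ge k f" "order_ge l g"
  shows "order_ge (k + l) (f * g)"
  unfolding order_ge_def
proof (intro allI impI)
  fix m :: "'v \<Rightarrow>\<^sub>0 nat" assume m: "monom_deg m < k + l"
  show "mfps_coeff (f * g) m = 0"
    unfolding mfps_coeff_mult
  proof (intro sum.neutral ballI, clarify)
    fix a b assume "(a, b) \<in> splits m"
    then have "monom_deg a < k \<or> monom_deg b < l"
      using m by (auto simp: splits_def monom_deg_add)
    then show "mfps_coeff f a * mfps_coeff g b = 0"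
      using assms by (auto simp: order_ge_def)
  qed
qed

lemma order_ge_const_mult: "order_ge k f \<Longrightarrow> order_ge k (mfps_const c * f)"
  by (simp add: order_ge_def)

lemma order_ge_sum: "(\<And>x. x \<in> S \<Longrightarrow> order_ge k (F x)) \<Longrightarrow> order_ge k (sum F S)"
  by (simp add: order_ge_def)

lemma order_ge_power: "order_ge 1 f \<Longrightarrow> order_ge k (f ^ k)"
proof (induction k)
  case (Suc k)
  then have "order_ge (1 + k) (f * f ^ k)"
    by (intro order_ge_mult)
  then show ?case
    by simp
qed simp

lemma order_ge_formal_sum:
  "(\<And>x. x \<in> S \<Longrightarrow> order_ge k (F x)) \<Longrightarrow> order_ge k (formal_sum F S)"
  by (auto simp: order_ge_def formal_sum_def)

lemma formally_summable_order:
  assumes "\<And>k. k \<in> S \<Longrightarrow> order_ge k (F k)"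
  shows "formally_summable F S"
  unfolding formally_summable_def
proof
  fix m
  have "{k\<in>S. mfps_coeff (F k) m \<noteq> 0} \<subseteq> {..monom_deg m}"
    using assms by (auto simp: order_ge_def not_less[symmetric])
  then show "finite {k\<in>S. mfps_coeff (F k) m \<noteq> 0}"
    by (rule finite_subset) simp
qed

lemma mfps_exp_summable:
  assumes "mfps_coeff f 0 = 0"
  shows "formally_summable (\<lambda>k. mfps_const (1 / fact k) * f ^ k) UNIV"
  using assms unfolding order_ge_1_iff[symmetric]
  by (intro formally_summable_order order_ge_const_mult order_ge_power)

lemma order_ge_matpow:
  assumes "\<And>i j. mfps_coeff (A $ i $ j) 0 = 0"
  shows "order_ge t (matpow A t $ i $ j)"
proof (induction t arbitrary: i j)
  case (Suc t)
  have "order_ge (1 + t) (A $ i $ k * matpow A t $ k $ j)" for k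
    using assms by (intro order_ge_mult Suc) (simp only: order_ge_1_iff)
  then show ?case
    by (simp add: matrix_matrix_mult_def order_ge_sum)
qed simp

lemma log_det_summable:
  assumes "\<And>i j. mfps_coeff (A $ i $ j) 0 = 0"
  shows "formally_summable (\<lambda>t. mfps_const (1 / of_nat t) * trace (matpow A t)) {1..}"
  unfolding trace_def
  by (intro formally_summable_order order_ge_const_mult order_ge_sum order_ge_matpow assms)

lemma log_det_coeff_0:
  assumes "\<And>i j. mfps_coeff (A $ i $ j) 0 = 0"
  shows "mfps_coeff (\<beta> * formal_sum (\<lambda>t. mfps_const (1 / of_nat t) * trace (matpow A t)) {1..}) 0 = 0"
proof -
  have *: "order_ge 1 (matpow A t $ i $ i)" if "t \<ge> 1" for t i
    using order_ge_matpow[of A t i i] assms that unfolding order_ge_def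
    by (meson order_less_le_trans)
  have "order_ge (0 + 1)
      (\<beta> * formal_sum (\<lambda>t. mfps_const (1 / of_nat t) * trace (matpow A t)) {1..})"
    unfolding trace_def
    by (intro order_ge_mult order_ge_formal_sum order_ge_const_mult order_ge_sum order_ge_0 *) auto
  then show ?thesis
    by (simp only: order_ge_1_iff add_0)
qed


section \<open>The extended deranged permanent\<close>

definition derangements :: "'x set \<Rightarrow> ('x \<Rightarrow> 'x) set" where
  "derangements X = {\<pi>. \<pi> permutes X \<and> (\<forall>x\<in>X. \<pi> x \<noteq> x)}"

text \<open>The cycles of a permutation of a finite set \<open>X\<close> are its orbits on \<open>X\<close>.\<close>

definition num_cycles :: "'x set \<Rightarrow> ('x \<Rightarrow> 'x) \<Rightarrow> nat" where
  "num_cycles X \<pi> = card (orbit \<pi> ` X)"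

definition dperm :: "'a::comm_ring_1 \<Rightarrow> 'x set \<Rightarrow> ('x \<Rightarrow> 'x \<Rightarrow> 'a) \<Rightarrow> 'a" where
  "dperm \<beta> X M = (\<Sum>\<pi>\<in>derangements X. \<beta> ^ num_cycles X \<pi> * (\<Prod>x\<in>X. M x (\<pi> x)))"

text \<open>The copy \<open>i\<^sub>a\<close> of the index \<open>i\<close>, where \<open>1 \<le> a \<le> r\<^sub>i\<close>, is the pair \<open>(i, a)\<close>.\<close>

definition multiset_index :: "nat ^ 'n \<Rightarrow> ('n \<times> nat) set" where
  "multiset_index r = (SIGMA i:UNIV. {1..r $ i})"

definition repeated_matrix :: "'a ^ 'n ^ 'n \<Rightarrow> 'n \<times> nat \<Rightarrow> 'n \<times> nat \<Rightarrow> 'a" where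
  "repeated_matrix A = (\<lambda>(i, a) (j, b). A $ i $ j)"


section \<open>The indeterminates\<close>

datatype 'n indet = Beta_indet | Entry_indet 'n 'n

end

theory Submission
  imports Defs
begin

text \<open>
  Grade power series by their degree in the matrix entries, \<open>\<beta>\<close> having degree \<open>0\<close>. The deranged
  permanent of \<open>A(n\<^sup>r, n\<^sup>r)\<close> is homogeneous of degree \<open>N = \<Sum>i. r\<^sub>i\<close>, so each homogeneous part of the left
  side is a finite sum, and it suffices to compare the two sides degree by degree. Both
  turn out to satisfy
  \<open>d\<^sub>0 = 1\<close>, \<open>d\<^sub>1 = 0\<close> and \<open>N d\<^sub>N = \<beta> (\<Sum>t=2..N. Tr (A\<^sup>t) d\<^bsub>N-t\<^esub>)\<close>,
  which determines the sequence over a field of characteristic \<open>0\<close>.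

  For the right side (\<open>hpart_exp_times_det\<close>) the recursion is a differential equation: the Euler
  operator, which multiplies a part of degree \<open>N\<close> by \<open>N\<close>, turns the exponential of \<open>f\<close> into its product
  with the derivative of \<open>f\<close>, and here that derivative is \<open>\<beta> (\<Sum>t\<ge>2. Tr (A\<^sup>t))\<close>.

  For the left side (\<open>dperm_part_rec\<close>) the recursion says: choose one of the \<open>N\<close> elements and remove the
  cycle through it. The cycle is consumed one element at a time (\<open>alpha_perm_insert\<close>): an element is
  contracted into its successor, which then becomes a marked element, remembering the colour in which
  the consumed stretch was entered, left from its own colour, and allowed to close the cycle. The
  generating function \<open>Q\<close> of permanents with such a mark satisfies a linear equation
  \<open>Q = \<beta> A F + A Q\<close>, where \<open>F\<close> is the left side, so \<open>Q\<close> is \<open>\<beta> (A + A\<^sup>2 + \<dots>) F\<close>, and \<open>N d\<^sub>N\<close> is a part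
  of the trace of \<open>A Q\<close>. Dividing by \<open>r!\<close> absorbs the choice among copies of the same index at each
  contraction (\<open>egf_part_shift\<close>).
\<close>

section \<open>The alpha-permanent\<close>

text \<open>This is \<^const>\<open>dperm\<close> with fixed points admitted (the \<open>\<alpha>\<close>-permanent). Admitting them
  loses nothing, since derangements are singled out by a zero diagonal, and it gives a recursion:
  contracting an element out of a derangement can create a fixed point, so derangements alone are
  not closed under it.\<close>

definition alpha_perm :: "'a::comm_ring_1 \<Rightarrow> 'x set \<Rightarrow> ('x \<Rightarrow> 'x \<Rightarrow> 'a) \<Rightarrow> 'a" where
  "alpha_perm \<beta> X M = (\<Sum>\<pi> | \<pi> permutes X. \<beta> ^ num_cycles X \<pi> * (\<Prod>x\<in>X. M x (\<pi> x)))"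

lemma alpha_perm_empty [simp]: "alpha_perm \<beta> {} M = 1"
  by (simp add: alpha_perm_def num_cycles_def)

lemma alpha_perm_cong:
  assumes "\<And>x y. x \<in> X \<Longrightarrow> y \<in> X \<Longrightarrow> M x y = M' x y"
  shows "alpha_perm \<beta> X M = alpha_perm \<beta> X M'"
  unfolding alpha_perm_def
  by (intro sum.cong refl arg_cong2[where f = "(*)"] prod.cong assms)
     (auto simp: permutes_in_image)

lemma dperm_eq_alpha_perm:
  assumes "finite X"
  shows "dperm \<beta> X M = alpha_perm \<beta> X (\<lambda>x y. if x = y then 0 else M x y)"
  unfolding dperm_def alpha_perm_def
proof (rule sum.mono_neutral_cong_left)
  show "finite {\<pi>. \<pi> permutes X}"
    using assms by (rule finite_permutations)
  show "derangements X \<subseteq> {\<pi>. \<pi> permutes X}"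
    by (auto simp: derangements_def)
  show "\<forall>\<pi>\<in>{\<pi>. \<pi> permutes X} - derangements X.
      \<beta> ^ num_cycles X \<pi> * (\<Prod>x\<in>X. if x = \<pi> x then 0 else M x (\<pi> x)) = 0"
  proof
    fix \<pi> assume "\<pi> \<in> {\<pi>. \<pi> permutes X} - derangements X"
    then obtain x where "x \<in> X" "\<pi> x = x"
      by (auto simp: derangements_def)
    then have "(\<Prod>x\<in>X. if x = \<pi> x then 0 else M x (\<pi> x)) = 0"
      using assms by (intro prod_zero) (auto intro: bexI[of _ x])
    then show "\<beta> ^ num_cycles X \<pi> * (\<Prod>x\<in>X. if x = \<pi> x then 0 else M x (\<pi> x)) = 0"
      by simp
  qed
  show "\<beta> ^ num_cycles X \<pi> * (\<Prod>x\<in>X. M x (\<pi> x))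
      = \<beta> ^ num_cycles X \<pi> * (\<Prod>x\<in>X. if x = \<pi> x then 0 else M x (\<pi> x))"
    if "\<pi> \<in> derangements X" for \<pi>
    using that
    by (intro arg_cong2[where f = "(*)"] refl prod.cong) (auto simp: derangements_def)
qed

lemma num_cycles_insert_fixed:
  assumes "finite X" "x \<notin> X" "q permutes X"
  shows "num_cycles (insert x X) q = Suc (num_cycles X q)"
proof -
  have "q x = x"
    using assms by (simp add: permutes_not_in)
  then have x: "orbit q x = {x}"
    by (simp add: orbit_eq_singleton_iff)
  have "orbit q z \<subseteq> X" if "z \<in> X" for z
    using assms(3) that by (simp add: permutes_orbit_subset)
  then have "orbit q x \<notin> orbit q ` X"
    using assms(2) x by auto
  then show ?thesis
    using assms(1) by (simp add: num_cycles_def)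
qed

text \<open>The permutation \<open>transpose x y \<circ> q\<close> is \<open>q\<close> with \<open>x\<close> spliced in just before \<open>y\<close>, so its cycles are
  those of \<open>q\<close>, one of them with the extra element \<open>x\<close>. The two inclusions follow the two
  permutations step by step, where one step of \<open>q\<close> into \<open>y\<close> is two steps of the other through \<open>x\<close>.\<close>

lemma orbit_transpose_comp:
  assumes "x \<notin> X" "y \<in> X" "q permutes X" "z \<in> X"
  shows "orbit (Transposition.transpose x y \<circ> q) z \<inter> X = orbit q z"
proof -
  define p where "p = Transposition.transpose x y \<circ> q"
  have qx: "q x = x"
    using assms by (simp add: permutes_not_in)
  have qin: "q w \<in> X \<longleftrightarrow> w \<in> X" for w
    using assms(3) by (rule permutes_in_image)
  have contract: "(if p w = x then y else p w) = q w" if "w \<noteq> x" for w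
  proof -
    have "q w \<noteq> x"
      using that qx assms(3) by (metis permutes_inj injD)
    then show ?thesis
      using assms(1,2) by (auto simp: p_def Transposition.transpose_def)
  qed
  have px: "p x = y"
    using qx by (simp add: p_def)
  have zx: "z \<noteq> x" and yx: "y \<noteq> x"
    using assms by auto
  have A: "(if w = x then y else w) \<in> orbit q z" if "w \<in> orbit p z" for w
    using that
  proof induction
    case base
    show ?case
      using contract[OF zx] by (simp add: orbit.base)
  next
    case (step w)
    show ?case
    proof (cases "w = x")
      case True
      then show ?thesis
        using step px yx by simp
    next
      case False
      then have "w \<in> orbit q z"
        using step by simp
      then have "q w \<in> orbit q z"
        by (rule orbit.step)
      then show ?thesis
        using False contract by simp
    qed
  qed
  have pstep: "q w \<in> orbit p z" if "p w \<in> orbit p z" "w \<noteq> x" for w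
  proof (cases "p w = x")
    case True
    then have "p x \<in> orbit p z"
      using orbit.step[OF that(1)] by simp
    then show ?thesis
      using contract[OF that(2)] True px by simp
  next
    case False
    then show ?thesis
      using contract[OF that(2)] that(1) by simp
  qed
  have B: "w \<in> orbit p z \<and> w \<in> X" if "w \<in> orbit q z" for w
    using that
  proof induction
    case base
    show ?case
      using pstep[OF orbit.base zx] assms(4) qin by simp
  next
    case (step w)
    then have "w \<noteq> x"
      using assms(1) by auto
    then show ?case
      using pstep[of w] orbit.step[of w p z] step qin by simp
  qed
  have "w \<in> orbit q z" if "w \<in> orbit p z" "w \<in> X" for w
    using A[OF that(1)] that(2) assms(1) by (metis (full_types))
  then show ?thesis
    using B unfolding p_def[symmetric] by blast
qed

text \<open>No cycle of the spliced permutation is \<open>{x}\<close>, so intersecting with \<open>X\<close> loses none of them and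
  merges no two.\<close>

lemma num_cycles_transpose_comp:
  assumes "finite X" "x \<notin> X" "y \<in> X" "q permutes X"
  shows "num_cycles (insert x X) (Transposition.transpose x y \<circ> q) = num_cycles X q"
proof -
  define p where "p = Transposition.transpose x y \<circ> q"
  have "q permutes insert x X"
    using assms(4) by (rule permutes_subset) auto
  then have perm: "p permutes insert x X"
    unfolding p_def using assms(3) by (intro permutes_compose permutes_swap_id) auto
  then have "permutation p"
    using assms(1) by (auto simp: permutation_permutes)
  then have self: "z \<in> orbit p z" for z
    by (rule permutation_self_in_orbit)
  have "q x = x"
    using assms by (simp add: permutes_not_in)
  then have "p x = y"
    by (simp add: p_def)
  then have "y \<in> orbit p x"
    using orbit.base[of p x] by simp
  then have "orbit p x = orbit p y"
    using self by (metis orbit_cyclic_eq3 cyclic_on_orbit' \<open>permutation p\<close>)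
  then have "orbit p ` insert x X = orbit p ` X"
    using assms(3) by auto
  moreover have "orbit q ` X = (\<lambda>S. S \<inter> X) ` (orbit p ` X)"
    using orbit_transpose_comp[OF assms(2,3,4)] by (simp add: image_image p_def)
  moreover have "inj_on (\<lambda>S. S \<inter> X) (orbit p ` X)"
  proof (rule inj_onI, clarify)
    fix u v assume uv: "u \<in> X" "v \<in> X" "orbit p u \<inter> X = orbit p v \<inter> X"
    then have "u \<in> orbit p v"
      using self[of u] by auto
    then show "orbit p u = orbit p v"
      by (metis orbit_cyclic_eq3 cyclic_on_orbit' \<open>permutation p\<close>)
  qed
  ultimately show ?thesis
    by (simp add: num_cycles_def card_image flip: p_def)
qed

text \<open>Contraction of \<open>x\<close>: either \<open>x\<close> is a cycle by itself, or it is followed by some \<open>y\<close>. In the second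
  case \<open>x\<close> is merged into \<open>y\<close>; the merged element is left as \<open>y\<close> is left but entered as \<open>x\<close> is
  entered, that is, the column of \<open>y\<close> is replaced by that of \<open>x\<close>. The number of cycles is unchanged.\<close>

lemma alpha_perm_insert:
  assumes "finite X" "x \<notin> X"
  shows "alpha_perm \<beta> (insert x X) M = \<beta> * M x x * alpha_perm \<beta> X M
    + (\<Sum>y\<in>X. M x y * alpha_perm \<beta> X (\<lambda>z w. if w = y then M z x else M z w))"
proof -
  let ?t = "\<lambda>\<pi>. \<beta> ^ num_cycles (insert x X) \<pi> * (\<Prod>z\<in>insert x X. M z (\<pi> z))"
  have fixed: "?t (Transposition.transpose x x \<circ> q)
      = \<beta> * M x x * (\<beta> ^ num_cycles X q * (\<Prod>z\<in>X. M z (q z)))" if "q permutes X" for q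
    using that assms num_cycles_insert_fixed[OF assms that]
    by (simp add: permutes_not_in[OF that assms(2)] mult_ac)
  have moved: "?t (Transposition.transpose x y \<circ> q) = M x y * (\<beta> ^ num_cycles X q *
      (\<Prod>z\<in>X. if q z = y then M z x else M z (q z)))" if "y \<in> X" "q permutes X" for y q
  proof -
    have "M z ((Transposition.transpose x y \<circ> q) z) = (if q z = y then M z x else M z (q z))"
      if "z \<in> X" for z
    proof -
      have "q z \<noteq> x"
        using \<open>q permutes X\<close> \<open>z \<in> X\<close> assms(2) permutes_in_image by metis
      then show ?thesis
        by (simp add: Transposition.transpose_def)
    qed
    then have "(\<Prod>z\<in>X. M z ((Transposition.transpose x y \<circ> q) z))
        = (\<Prod>z\<in>X. if q z = y then M z x else M z (q z))"
      by (intro prod.cong) auto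
    moreover have "(Transposition.transpose x y \<circ> q) x = y"
      using that(2) assms(2) by (simp add: permutes_not_in)
    ultimately show ?thesis
      using assms num_cycles_transpose_comp[OF assms that] by (simp add: mult_ac)
  qed
  have "alpha_perm \<beta> (insert x X) M
      = (\<Sum>y\<in>insert x X. \<Sum>q | q permutes X. ?t (Transposition.transpose x y \<circ> q))"
    unfolding alpha_perm_def using assms by (intro sum_over_permutations_insert)
  also have "\<dots> = (\<Sum>q | q permutes X. ?t (Transposition.transpose x x \<circ> q))
      + (\<Sum>y\<in>X. \<Sum>q | q permutes X. ?t (Transposition.transpose x y \<circ> q))"
    using assms by simp
  also have "(\<Sum>q | q permutes X. ?t (Transposition.transpose x x \<circ> q)) = \<beta> * M x x * alpha_perm \<beta> X M"
    unfolding alpha_perm_def sum_distrib_left by (rule sum.cong) (use fixed in auto)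
  also have "(\<Sum>y\<in>X. \<Sum>q | q permutes X. ?t (Transposition.transpose x y \<circ> q))
      = (\<Sum>y\<in>X. M x y * alpha_perm \<beta> X (\<lambda>z w. if w = y then M z x else M z w))"
    unfolding alpha_perm_def sum_distrib_left
    by (intro sum.cong refl) (use moved in auto)
  finally show ?thesis .
qed

text \<open>Since the recursion determines the \<open>\<alpha>\<close>-permanent, invariance under relabelling follows from it by
  induction, and conjugated permutations and their cycles need not be discussed.\<close>

lemma alpha_perm_image:
  assumes "finite X" "inj_on g X"
  shows "alpha_perm \<beta> (g ` X) M = alpha_perm \<beta> X (\<lambda>x y. M (g x) (g y))"
  using assms
proof (induction X arbitrary: M rule: finite_induct)
  case (insert x X)
  then have inj: "inj_on g X" and gx: "g x \<notin> g ` X"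
    by auto
  have "alpha_perm \<beta> (g ` X) (\<lambda>z w. if w = g y then M z (g x) else M z w)
      = alpha_perm \<beta> X (\<lambda>z w. if w = y then M (g z) (g x) else M (g z) (g w))" if "y \<in> X" for y
    unfolding insert.IH[OF inj]
    by (rule alpha_perm_cong) (use inj that in \<open>auto simp: inj_on_eq_iff\<close>)
  then show ?case
    using insert inj gx by (simp add: alpha_perm_insert sum.reindex)
qed simp

section \<open>Deranged permanents of repeated matrices\<close>

definition deranged_matrix :: "'a::zero ^ 'n ^ 'n \<Rightarrow> 'n \<times> nat \<Rightarrow> 'n \<times> nat \<Rightarrow> 'a" where
  "deranged_matrix A z w = (if z = w then 0 else A $ fst z $ fst w)"

text \<open>The matrix that arises by contraction: the element \<open>x\<close> stands for a stretch of a cycle that is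
  entered in colour \<open>i\<close> and left from colour \<open>j\<close>. It may be mapped to itself, which closes the
  stretch to a cycle with at least two elements of the original set.\<close>

definition marked_matrix ::
    "'a::zero ^ 'n ^ 'n \<Rightarrow> 'n \<times> nat \<Rightarrow> 'n \<Rightarrow> 'n \<Rightarrow> 'n \<times> nat \<Rightarrow> 'n \<times> nat \<Rightarrow> 'a" where
  "marked_matrix A x i j z w =
     (if z = w \<and> z \<noteq> x then 0
      else A $ (if z = x then j else fst z) $ (if w = x then i else fst w))"

lemma finite_multiset_index [simp]: "finite (multiset_index (r :: nat ^ 'n::finite))"
  by (simp add: multiset_index_def)

lemma card_multiset_index: "card (multiset_index (r :: nat ^ 'n::finite)) = (\<Sum>i\<in>UNIV. r $ i)"
  by (simp add: multiset_index_def)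

lemma in_multiset_index: "(i, a) \<in> multiset_index r \<longleftrightarrow> 1 \<le> a \<and> a \<le> r $ i"
  by (auto simp: multiset_index_def)

lemma multiset_index_axis: "multiset_index (r + axis k 1) = insert (k, Suc (r $ k)) (multiset_index r)"
  by (auto simp: multiset_index_def axis_def le_Suc_eq split: if_splits)

lemma dperm_repeated_matrix:
  fixes A :: "'a::comm_ring_1 ^ 'n ^ 'n::finite"
  shows "dperm \<beta> (multiset_index r) (repeated_matrix A)
    = alpha_perm \<beta> (multiset_index r) (deranged_matrix A)"
  unfolding dperm_eq_alpha_perm[OF finite_multiset_index]
  by (rule alpha_perm_cong) (auto simp: repeated_matrix_def deranged_matrix_def)

definition marked_perm ::
    "'a::comm_ring_1 \<Rightarrow> 'a ^ 'n ^ 'n \<Rightarrow> ('n \<times> nat) set \<Rightarrow> 'n \<times> nat \<Rightarrow> 'n \<Rightarrow> 'n \<Rightarrow> 'a" where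
  "marked_perm \<beta> A X x i j = alpha_perm \<beta> (insert x X) (marked_matrix A x i j)"

text \<open>The zero diagonal kills the term in which \<open>x\<close> is fixed; contracting \<open>x\<close> into \<open>y\<close> marks \<open>y\<close>.\<close>

lemma alpha_perm_deranged_insert:
  assumes "finite X" "x \<notin> X"
  shows "alpha_perm \<beta> (insert x X) (deranged_matrix A)
    = (\<Sum>y\<in>X. A $ fst x $ fst y * marked_perm \<beta> A (X - {y}) y (fst x) (fst y))"
proof -
  have "alpha_perm \<beta> X (\<lambda>z w. if w = y then deranged_matrix A z x else deranged_matrix A z w)
      = marked_perm \<beta> A (X - {y}) y (fst x) (fst y)" if "y \<in> X" for y
    unfolding marked_perm_def insert_Diff[OF that]
    by (rule alpha_perm_cong)
       (use assms(2) in \<open>auto simp: deranged_matrix_def marked_matrix_def\<close>)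
  moreover have "deranged_matrix A x y = A $ fst x $ fst y" if "y \<in> X" for y
    using that assms(2) by (auto simp: deranged_matrix_def)
  ultimately show ?thesis
    by (simp add: alpha_perm_insert[OF assms] deranged_matrix_def[of A x x])
qed

text \<open>Contracting the mark into \<open>y\<close> moves it there: the stretch is prolonged by \<open>y\<close>, so it keeps its
  entry colour and is now left from the colour of \<open>y\<close>.\<close>

lemma marked_perm_unfold:
  assumes "finite X" "x \<notin> X"
  shows "marked_perm \<beta> A X x i j = \<beta> * A $ j $ i * alpha_perm \<beta> X (deranged_matrix A)
    + (\<Sum>y\<in>X. A $ j $ fst y * marked_perm \<beta> A (X - {y}) y i (fst y))"
proof -
  let ?M = "marked_matrix A x i j"
  have "alpha_perm \<beta> X (\<lambda>z w. if w = y then ?M z x else ?M z w)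
      = marked_perm \<beta> A (X - {y}) y i (fst y)" if "y \<in> X" for y
    unfolding marked_perm_def insert_Diff[OF that]
    by (rule alpha_perm_cong) (use assms(2) in \<open>auto simp: marked_matrix_def\<close>)
  moreover have "alpha_perm \<beta> X ?M = alpha_perm \<beta> X (deranged_matrix A)"
    by (rule alpha_perm_cong)
       (use assms(2) in \<open>auto simp: deranged_matrix_def marked_matrix_def\<close>)
  moreover have "?M x y = A $ j $ fst y" if "y \<in> X" for y
    using that assms(2) by (auto simp: marked_matrix_def)
  ultimately show ?thesis
    unfolding marked_perm_def
    by (simp add: alpha_perm_insert[OF assms] marked_matrix_def[of A x i j x x])
qed

text \<open>Only colours matter: unmarked elements may be renamed within their colour, and the marked one
  freely, since its two colours are the parameters \<open>i\<close> and \<open>j\<close>.\<close>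

lemma marked_perm_relabel:
  assumes "finite X" "x \<notin> X" "bij_betw g X Y" "y \<notin> Y" "\<And>z. z \<in> X \<Longrightarrow> fst (g z) = fst z"
  shows "marked_perm \<beta> A Y y i j = marked_perm \<beta> A X x i j"
proof -
  let ?h = "g(x := y)"
  have Y: "g ` X = Y" and inj: "inj_on g X"
    using assms(3) by (auto simp: bij_betw_def)
  have hX: "?h ` X = Y"
    unfolding Y[symmetric] using assms(2) by (intro image_cong) auto
  have img: "insert y Y = ?h ` insert x X"
    unfolding image_insert hX by simp
  have y: "g z \<noteq> y" "z \<noteq> x" if "z \<in> X" for z
    using that assms(2,4) Y by auto
  have inj_h: "inj_on ?h (insert x X)"
  proof -
    have "inj_on ?h X"
      using inj assms(2) by (auto simp: inj_on_def)
    moreover have "?h x \<notin> ?h ` (X - {x})"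
      unfolding Diff_insert0[OF assms(2)] Diff_empty hX using assms(4) by simp
    ultimately show ?thesis
      unfolding inj_on_insert by blast
  qed
  have fin: "finite (insert x X)"
    using assms(1) by simp
  show ?thesis
    unfolding marked_perm_def img alpha_perm_image[OF fin inj_h]
    by (rule alpha_perm_cong)
       (use y inj assms(2,5) in \<open>auto simp: marked_matrix_def inj_on_eq_iff\<close>)
qed

text \<open>Copies are numbered from \<open>1\<close>, so \<open>(i, 0)\<close> is a fresh name for the marked element.\<close>

definition marked_dperm :: "'a::comm_ring_1 \<Rightarrow> 'a ^ 'n ^ 'n \<Rightarrow> nat ^ 'n \<Rightarrow> 'n \<Rightarrow> 'n \<Rightarrow> 'a" where
  "marked_dperm \<beta> A r i j = marked_perm \<beta> A (multiset_index r) (i, 0) i j"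

text \<open>The \<open>r\<^sub>k\<close> copies of \<open>k\<close> contribute equally, by a transposition with the last copy, whose removal
  leaves exactly the multiset in which the multiplicity of \<open>k\<close> is lowered by one.\<close>

lemma sum_marked_perm:
  fixes A :: "'a::comm_ring_1 ^ 'n ^ 'n::finite" and r :: "nat ^ 'n"
  shows "(\<Sum>y\<in>multiset_index r. A $ j $ fst y * marked_perm \<beta> A (multiset_index r - {y}) y i (fst y))
    = (\<Sum>k\<in>UNIV. A $ j $ k * (of_nat (r $ k) * marked_dperm \<beta> A (r - axis k 1) i k))"
proof -
  have eq: "marked_perm \<beta> A (multiset_index r - {(k, a)}) (k, a) i k = marked_dperm \<beta> A (r - axis k 1) i k"
    if a: "a \<in> {1..r $ k}" for k a
  proof -
    let ?X = "multiset_index r" and ?g = "Transposition.transpose (k, a) (k, r $ k)"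
    have "(r - axis k 1) + axis k 1 = r"
      using a by (auto simp: vec_eq_iff axis_def)
    then have "?X = insert (k, Suc ((r - axis k 1) $ k)) (multiset_index (r - axis k 1))"
      using multiset_index_axis[of "r - axis k 1" k] by simp
    moreover have "Suc ((r - axis k 1) $ k) = r $ k"
      using a by (simp add: axis_def)
    ultimately have X': "multiset_index (r - axis k 1) = ?X - {(k, r $ k)}"
      using in_multiset_index[of k "r $ k" "r - axis k 1"] by auto
    have "?g permutes ?X"
      using a by (intro permutes_swap_id) (auto simp: in_multiset_index)
    then have "bij_betw ?g (?X - {(k, a)}) (?g ` (?X - {(k, a)}))"
      by (meson inj_on_imp_bij_betw permutes_inj_on)
    moreover have "?g ` (?X - {(k, a)}) = ?X - {(k, r $ k)}"
      using \<open>?g permutes ?X\<close> permutes_image[OF \<open>?g permutes ?X\<close>]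
      by (subst image_set_diff) (auto dest: permutes_inj)
    ultimately have "bij_betw ?g (?X - {(k, a)}) (multiset_index (r - axis k 1))"
      using X' by simp
    then show ?thesis
      unfolding marked_dperm_def
      by (intro marked_perm_relabel[symmetric, of _ _ ?g])
         (auto simp: in_multiset_index Transposition.transpose_def)
  qed
  have "(\<Sum>y\<in>multiset_index r. A $ j $ fst y * marked_perm \<beta> A (multiset_index r - {y}) y i (fst y))
     = (\<Sum>k\<in>UNIV. \<Sum>a\<in>{1..r $ k}.
         A $ j $ k * marked_perm \<beta> A (multiset_index r - {(k, a)}) (k, a) i k)"
    unfolding multiset_index_def by (subst sum.Sigma) (auto simp: case_prod_unfold)
  also have "\<dots> = (\<Sum>k\<in>UNIV. \<Sum>a\<in>{1..r $ k}. A $ j $ k * marked_dperm \<beta> A (r - axis k 1) i k)"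
    by (intro sum.cong refl) (simp only: eq)
  also have "\<dots> = (\<Sum>k\<in>UNIV. A $ j $ k * (of_nat (r $ k) * marked_dperm \<beta> A (r - axis k 1) i k))"
    by (simp add: mult_ac)
  finally show ?thesis .
qed

lemma dperm_add_axis:
  fixes A :: "'a::comm_ring_1 ^ 'n ^ 'n::finite"
  shows "dperm \<beta> (multiset_index (r + axis i 1)) (repeated_matrix A)
    = (\<Sum>k\<in>UNIV. A $ i $ k * (of_nat (r $ k) * marked_dperm \<beta> A (r - axis k 1) i k))"
proof -
  have "(i, Suc (r $ i)) \<notin> multiset_index r"
    by (simp add: in_multiset_index)
  then show ?thesis
    unfolding dperm_repeated_matrix unfolding multiset_index_axis sum_marked_perm[symmetric]
    by (simp add: alpha_perm_deranged_insert)
qed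

lemma marked_dperm_unfold:
  fixes A :: "'a::comm_ring_1 ^ 'n ^ 'n::finite"
  shows "marked_dperm \<beta> A r i j
    = \<beta> * A $ j $ i * dperm \<beta> (multiset_index r) (repeated_matrix A)
    + (\<Sum>k\<in>UNIV. A $ j $ k * (of_nat (r $ k) * marked_dperm \<beta> A (r - axis k 1) i k))"
proof -
  have "(i, 0) \<notin> multiset_index r"
    by (simp add: in_multiset_index)
  then show ?thesis
    unfolding marked_dperm_def[of \<beta> A r] dperm_repeated_matrix sum_marked_perm[symmetric]
    by (intro marked_perm_unfold) simp
qed

section \<open>The exponential generating function in the multiplicities\<close>

definition vecs_of_sum :: "nat \<Rightarrow> (nat ^ 'n::finite) set" where
  "vecs_of_sum N = {r. (\<Sum>i\<in>UNIV. r $ i) = N}"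

lemma finite_vecs_of_sum [simp]: "finite (vecs_of_sum N :: (nat ^ 'n::finite) set)"
proof -
  have "vec_nth ` (vecs_of_sum N :: (nat ^ 'n) set) \<subseteq> PiE UNIV (\<lambda>_. {..N})"
    by (auto simp: vecs_of_sum_def intro!: member_le_sum)
  then have "finite (vec_nth ` (vecs_of_sum N :: (nat ^ 'n) set))"
    by (rule finite_subset) (auto intro: finite_PiE)
  then show ?thesis
    by (rule finite_imageD) (auto simp: inj_on_def vec_nth_inject)
qed

text \<open>The part of an exponential generating function in \<open>r\<close> that comes from the multiplicities of total
  \<open>N\<close>. A finite sum, so that it can be manipulated without regard to summability.\<close>

definition egf_part :: "nat \<Rightarrow> (nat ^ 'n::finite \<Rightarrow> ('v, 'a::field_char_0) mfps) \<Rightarrow> ('v, 'a) mfps" where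
  "egf_part N f = (\<Sum>r\<in>vecs_of_sum N. mfps_const (1 / (\<Prod>i\<in>UNIV. fact (r $ i))) * f r)"

lemma mfps_const_of_nat:
  "mfps_const (of_nat n :: 'a::comm_ring_1) = (of_nat n :: ('v, 'a) mfps)"
proof (induction n)
  case (Suc n)
  have "mfps_coeff (of_nat n :: ('v, 'a) mfps) m = (if m = 0 then of_nat n else 0)" for m
    unfolding Suc[symmetric] by (simp add: mfps_const_def)
  then show ?case
    by (auto simp: mfps_eq_iff mfps_const_def mfps_coeff_1)
qed (simp add: mfps_eq_iff mfps_const_def)

lemma mfps_const_1 [simp]: "mfps_const 1 = 1"
  using mfps_const_of_nat[of 1] by simp

lemma mfps_coeff_of_nat_mult [simp]: "mfps_coeff (of_nat n * f) m = of_nat n * mfps_coeff f m"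
  by (simp flip: mfps_const_of_nat)

lemma egf_part_add: "egf_part N (\<lambda>r. f r + g r) = egf_part N f + egf_part N g"
  by (simp add: egf_part_def sum.distrib algebra_simps)

lemma egf_part_mult_left: "egf_part N (\<lambda>r. c * f r) = c * egf_part N f"
  by (simp add: egf_part_def sum_distrib_left mult_ac)

lemma egf_part_sum: "egf_part N (\<lambda>r. \<Sum>k\<in>K. f k r) = (\<Sum>k\<in>K. egf_part N (f k))"
  unfolding egf_part_def sum_distrib_left by (rule sum.swap)

text \<open>The factor \<open>r\<^sub>k\<close> cancels against \<open>r!\<close>; for \<open>r\<^sub>k = 0\<close>, where the subtraction truncates, it makes the
  term vanish. This is why the recursions for fixed multiplicities become linear recursions for the
  parts of the generating functions.\<close>

lemma egf_part_shift:
  fixes f :: "nat ^ 'n::finite \<Rightarrow> ('v, 'a::field_char_0) mfps"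
  shows "egf_part (Suc N) (\<lambda>r. of_nat (r $ k) * f (r - axis k 1)) = egf_part N f"
proof -
  let ?c = "\<lambda>r :: nat ^ 'n. 1 / (\<Prod>i\<in>UNIV. fact (r $ i)) :: 'a"
  have plus: "(\<Sum>i\<in>UNIV. (r + axis k 1) $ i) = Suc (\<Sum>i\<in>UNIV. r $ i)" for r :: "nat ^ 'n"
    by (simp add: sum.distrib axis_def)
  have minus: "(r - axis k 1) + axis k 1 = r" if "r $ k \<noteq> 0" for r :: "nat ^ 'n"
    using that by (auto simp: vec_eq_iff axis_def)
  have pred: "r - axis k 1 \<in> vecs_of_sum N" if "r \<in> vecs_of_sum (Suc N)" "r $ k \<noteq> 0" for r :: "nat ^ 'n"
    using plus[of "r - axis k 1", unfolded minus[OF that(2)]] that(1)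
    by (simp add: vecs_of_sum_def del: vector_minus_component)
  have fact: "of_nat (Suc (r $ k)) * ?c (r + axis k 1) = ?c r" for r :: "nat ^ 'n"
  proof -
    have "(\<Prod>i\<in>UNIV. fact ((r + axis k 1) $ i) :: 'a)
        = fact (Suc (r $ k)) * (\<Prod>i\<in>UNIV - {k}. fact (r $ i))"
      by (subst prod.remove[of _ k]) (auto simp: axis_def intro!: prod.cong)
    moreover have "(\<Prod>i\<in>UNIV. fact (r $ i) :: 'a) = fact (r $ k) * (\<Prod>i\<in>UNIV - {k}. fact (r $ i))"
      by (subst prod.remove[of _ k]) auto
    ultimately show ?thesis
      by (simp del: of_nat_Suc)
  qed
  have weight: "mfps_const (?c (r + axis k 1)) * (of_nat (Suc (r $ k)) * g) = mfps_const (?c r) * g"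
    for r and g :: "('v, 'a) mfps"
  proof (rule mfps_eqI)
    fix m
    have "mfps_coeff (mfps_const (?c (r + axis k 1)) * (of_nat (Suc (r $ k)) * g)) m
        = of_nat (Suc (r $ k)) * ?c (r + axis k 1) * mfps_coeff g m"
      by (simp only: mfps_coeff_const_mult mfps_coeff_of_nat_mult) (simp only: mult_ac)
    then show "mfps_coeff (mfps_const (?c (r + axis k 1)) * (of_nat (Suc (r $ k)) * g)) m
        = mfps_coeff (mfps_const (?c r) * g) m"
      by (simp only: fact mfps_coeff_const_mult)
  qed
  have "egf_part (Suc N) (\<lambda>r. of_nat (r $ k) * f (r - axis k 1))
      = (\<Sum>r | r \<in> vecs_of_sum (Suc N) \<and> r $ k \<noteq> 0.
          mfps_const (?c r) * (of_nat (r $ k) * f (r - axis k 1)))"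
    unfolding egf_part_def by (rule sum.mono_neutral_right) auto
  also have "\<dots> = (\<Sum>r\<in>vecs_of_sum N.
      mfps_const (?c (r + axis k 1)) * (of_nat (Suc (r $ k)) * f r))"
    by (rule sum.reindex_bij_witness[of _ "\<lambda>r. r + axis k 1" "\<lambda>r. r - axis k 1"])
       (use minus pred plus in \<open>auto simp: vecs_of_sum_def\<close>)
  also have "\<dots> = egf_part N f"
    unfolding egf_part_def
    by (intro sum.cong refl weight)
  finally show ?thesis .
qed

definition dperm_part :: "('v, 'a::field_char_0) mfps \<Rightarrow> ('v, 'a) mfps ^ 'n ^ 'n::finite \<Rightarrow> nat \<Rightarrow> ('v, 'a) mfps" where
  "dperm_part \<beta> A N = egf_part N (\<lambda>r. dperm \<beta> (multiset_index r) (repeated_matrix A))"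

lemma dperm_part_0: "dperm_part \<beta> A 0 = 1"
proof -
  have "vecs_of_sum 0 = {0 :: nat ^ 'c}"
    by (auto simp: vecs_of_sum_def vec_eq_iff)
  moreover have "multiset_index (0 :: nat ^ 'c) = {}"
    by (auto simp: multiset_index_def)
  ultimately show ?thesis
    by (simp add: dperm_part_def egf_part_def dperm_repeated_matrix)
qed

lemma egf_part_marked:
  fixes \<beta> :: "('v, 'a::field_char_0) mfps" and A :: "('v, 'a) mfps ^ 'n ^ 'n::finite"
  defines "U \<equiv> \<lambda>i j r. \<Sum>k\<in>UNIV. A $ j $ k * (of_nat (r $ k) * marked_dperm \<beta> A (r - axis k 1) i k)"
  shows "egf_part (Suc N) (U i j) = (\<Sum>k\<in>UNIV. A $ j $ k * egf_part N (\<lambda>r. marked_dperm \<beta> A r i k))"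
    and "egf_part 0 (U i j) = 0"
proof -
  show "egf_part (Suc N) (U i j) = (\<Sum>k\<in>UNIV. A $ j $ k * egf_part N (\<lambda>r. marked_dperm \<beta> A r i k))"
    unfolding U_def egf_part_sum egf_part_mult_left
    by (intro sum.cong refl arg_cong2[where f = "(*)"] egf_part_shift)
  show "egf_part 0 (U i j) = 0"
    by (simp add: U_def egf_part_def vecs_of_sum_def)
qed

text \<open>The recursion for marked permanents is \<open>Q = \<beta> A F + A Q\<close> in terms of generating functions, whence
  \<open>Q = \<beta> (A + A\<^sup>2 + \<dots>) F\<close>; the induction is the expansion of this geometric series.\<close>

lemma egf_part_marked_dperm:
  "egf_part N (\<lambda>r. marked_dperm \<beta> A r i j)
     = \<beta> * (\<Sum>s\<le>N. matpow A (Suc s) $ j $ i * dperm_part \<beta> A (N - s))"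
proof (induction N arbitrary: j)
  case 0
  show ?case
    unfolding marked_dperm_unfold[of \<beta> A _ i j] egf_part_add egf_part_mult_left egf_part_marked
    by (simp add: dperm_part_def mult_ac)
next
  case (Suc N)
  have "egf_part (Suc N) (\<lambda>r. marked_dperm \<beta> A r i j) = \<beta> * A $ j $ i * dperm_part \<beta> A (Suc N)
      + (\<Sum>k\<in>UNIV. A $ j $ k * (\<beta> * (\<Sum>s\<le>N. matpow A (Suc s) $ k $ i * dperm_part \<beta> A (N - s))))"
    unfolding marked_dperm_unfold[of \<beta> A _ i j] egf_part_add egf_part_mult_left egf_part_marked Suc
      dperm_part_def[symmetric] ..
  also have "(\<Sum>k\<in>UNIV. A $ j $ k * (\<beta> * (\<Sum>s\<le>N. matpow A (Suc s) $ k $ i * dperm_part \<beta> A (N - s))))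
      = (\<Sum>s\<le>N. \<Sum>k\<in>UNIV. A $ j $ k * (\<beta> * (matpow A (Suc s) $ k $ i * dperm_part \<beta> A (N - s))))"
    unfolding sum_distrib_left by (rule sum.swap)
  also have "\<dots> = \<beta> * (\<Sum>s\<le>N. matpow A (Suc (Suc s)) $ j $ i * dperm_part \<beta> A (N - s))"
    unfolding sum_distrib_left matpow.simps(2)[of A "Suc s" for s]
    by (intro sum.cong refl)
       (simp add: matrix_matrix_mult_def sum_distrib_left sum_distrib_right mult_ac del: matpow.simps)
  finally show ?case
    unfolding sum.atMost_Suc_shift by (simp add: distrib_left mult_ac del: matpow.simps(2)) simp
qed

text \<open>The total number of elements is the sum of the \<open>r\<^sub>i\<close>, and \<open>r\<^sub>i\<close> counts the ways of choosing a copy of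
  \<open>i\<close> to contract. The cycle through the chosen copy starts and ends in colour \<open>i\<close>, so that summation over
  \<open>i\<close> produces traces. They start with \<open>A\<^sup>2\<close> because fixed points are excluded at the first step.\<close>

lemma dperm_part_rec:
  fixes \<beta> :: "('v, 'a::field_char_0) mfps" and A :: "('v, 'a) mfps ^ 'n ^ 'n::finite"
  shows "of_nat (Suc (Suc N)) * dperm_part \<beta> A (Suc (Suc N))
      = \<beta> * (\<Sum>s\<le>N. trace (matpow A (Suc (Suc s))) * dperm_part \<beta> A (N - s))"
    and "dperm_part \<beta> A 1 = 0"
proof -
  define U where "U = (\<lambda>i r. \<Sum>k\<in>UNIV. A $ i $ k * (of_nat (r $ k) * marked_dperm \<beta> A (r - axis k 1) i k))"
  define d where "d = (\<lambda>r :: nat ^ 'n. dperm \<beta> (multiset_index r) (repeated_matrix A))"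
  have d: "of_nat (r $ i) * d r = of_nat (r $ i) * U i (r - axis i 1)" for i r
  proof (cases "r $ i = 0")
    case False
    then have "r - axis i 1 + axis i 1 = r"
      by (auto simp: vec_eq_iff axis_def)
    then have "d r = U i (r - axis i 1)"
      using dperm_add_axis[of \<beta> "r - axis i 1" i A] by (simp add: d_def U_def)
    then show ?thesis
      by simp
  qed simp
  have main: "of_nat (Suc M) * dperm_part \<beta> A (Suc M) = (\<Sum>i\<in>UNIV. egf_part M (U i))" for M
  proof -
    have "of_nat (Suc M) * dperm_part \<beta> A (Suc M)
        = egf_part (Suc M) (\<lambda>r. of_nat (\<Sum>i\<in>UNIV. r $ i) * d r)"
      unfolding dperm_part_def d_def egf_part_mult_left[symmetric]
      unfolding egf_part_def
      by (rule sum.cong) (simp_all add: vecs_of_sum_def del: of_nat_sum of_nat_Suc)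
    also have "\<dots> = egf_part (Suc M) (\<lambda>r. \<Sum>i\<in>UNIV. of_nat (r $ i) * U i (r - axis i 1))"
      by (simp add: sum_distrib_right d)
    finally show ?thesis
      unfolding egf_part_sum egf_part_shift .
  qed
  have "of_nat (Suc (Suc N)) * dperm_part \<beta> A (Suc (Suc N))
      = (\<Sum>i\<in>UNIV. \<Sum>k\<in>UNIV. A $ i $ k *
          (\<beta> * (\<Sum>s\<le>N. matpow A (Suc s) $ k $ i * dperm_part \<beta> A (N - s))))"
    unfolding main U_def egf_part_marked egf_part_marked_dperm ..
  also have "\<dots> = (\<Sum>i\<in>UNIV. \<Sum>s\<le>N. \<Sum>k\<in>UNIV. A $ i $ k *
          (\<beta> * (matpow A (Suc s) $ k $ i * dperm_part \<beta> A (N - s))))"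
    unfolding sum_distrib_left by (intro sum.cong refl sum.swap)
  also have "\<dots> = (\<Sum>i\<in>UNIV. \<Sum>s\<le>N. \<beta> * (matpow A (Suc (Suc s)) $ i $ i * dperm_part \<beta> A (N - s)))"
    unfolding matpow.simps(2)[of A "Suc s" for s]
    by (intro sum.cong refl)
       (simp add: matrix_matrix_mult_def sum_distrib_left sum_distrib_right mult_ac del: matpow.simps)
  also have "\<dots> = \<beta> * (\<Sum>s\<le>N. trace (matpow A (Suc (Suc s))) * dperm_part \<beta> A (N - s))"
    unfolding sum_distrib_left trace_def sum_distrib_right by (rule sum.swap)
  finally show "of_nat (Suc (Suc N)) * dperm_part \<beta> A (Suc (Suc N))
      = \<beta> * (\<Sum>s\<le>N. trace (matpow A (Suc (Suc s))) * dperm_part \<beta> A (N - s))" .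
  show "dperm_part \<beta> A 1 = 0"
    using main[of 0] unfolding U_def egf_part_marked by simp
qed

section \<open>Weighted homogeneous parts\<close>

definition wdeg :: "('v \<Rightarrow> nat) \<Rightarrow> ('v \<Rightarrow>\<^sub>0 nat) \<Rightarrow> nat" where
  "wdeg w m = (\<Sum>v\<in>Poly_Mapping.keys m. Poly_Mapping.lookup m v * w v)"

lemma wdeg_add: "wdeg w (a + b) = wdeg w a + wdeg w b"
  unfolding wdeg_def by (rule setsum_keys_plus_distrib) (auto simp: distrib_right)

lemma wdeg_0 [simp]: "wdeg w 0 = 0"
  by (simp add: wdeg_def)

definition hpart :: "('v \<Rightarrow> nat) \<Rightarrow> nat \<Rightarrow> ('v, 'a::comm_ring_1) mfps \<Rightarrow> ('v, 'a) mfps" where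
  "hpart w N f = Abs_mfps (\<lambda>m. if wdeg w m = N then mfps_coeff f m else 0)"

lemma mfps_coeff_hpart [simp]: "mfps_coeff (hpart w N f) m = (if wdeg w m = N then mfps_coeff f m else 0)"
  by (simp add: hpart_def)

lemma hpart_mult:
  fixes f g :: "('v, 'a::comm_ring_1) mfps"
  shows "hpart w N (f * g) = (\<Sum>t\<le>N. hpart w t f * hpart w (N - t) g)"
proof (rule mfps_eqI)
  fix m
  have "mfps_coeff (\<Sum>t\<le>N. hpart w t f * hpart w (N - t) g) m
      = (\<Sum>(a, b)\<in>splits m. \<Sum>t\<le>N. mfps_coeff (hpart w t f) a * mfps_coeff (hpart w (N - t) g) b)"
    unfolding mfps_coeff_sum mfps_coeff_mult case_prod_unfold by (rule sum.swap)
  also have "\<dots> = (\<Sum>(a, b)\<in>splits m. if wdeg w m = N then mfps_coeff f a * mfps_coeff g b else 0)"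
  proof (intro sum.cong refl, clarify)
    fix a b assume "(a, b) \<in> splits m"
    then have m: "wdeg w m = wdeg w a + wdeg w b"
      by (auto simp: splits_def wdeg_add)
    have "(\<Sum>t\<le>N. mfps_coeff (hpart w t f) a * mfps_coeff (hpart w (N - t) g) b)
        = (\<Sum>t\<le>N. if t = wdeg w a then
            mfps_coeff f a * mfps_coeff (hpart w (N - wdeg w a) g) b else 0)"
      by (intro sum.cong) auto
    also have "\<dots> = (if wdeg w m = N then mfps_coeff f a * mfps_coeff g b else 0)"
      using m by (auto simp: sum.delta)
    finally show "(\<Sum>t\<le>N. mfps_coeff (hpart w t f) a * mfps_coeff (hpart w (N - t) g) b)
        = (if wdeg w m = N then mfps_coeff f a * mfps_coeff g b else 0)" .
  qed
  also have "\<dots> = mfps_coeff (hpart w N (f * g)) m"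
    by (simp add: mfps_coeff_mult)
  finally show "mfps_coeff (hpart w N (f * g)) m
      = mfps_coeff (\<Sum>t\<le>N. hpart w t f * hpart w (N - t) g) m" ..
qed

definition homogeneous :: "('v \<Rightarrow> nat) \<Rightarrow> nat \<Rightarrow> ('v, 'a::comm_ring_1) mfps \<Rightarrow> bool" where
  "homogeneous w N f \<longleftrightarrow> (\<forall>m. mfps_coeff f m \<noteq> 0 \<longrightarrow> wdeg w m = N)"

lemma hpart_homogeneous: "homogeneous w N f \<Longrightarrow> hpart w t f = (if t = N then f else 0)"
  by (auto intro!: mfps_eqI simp: homogeneous_def)

lemma homogeneous_0 [simp]: "homogeneous w N 0"
  by (simp add: homogeneous_def)

lemma homogeneous_1: "homogeneous w 0 1"
  by (simp add: homogeneous_def mfps_coeff_1)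

lemma homogeneous_var: "homogeneous w (w v) (mfps_var v)"
  by (simp add: homogeneous_def mfps_var_def wdeg_def)

lemma homogeneous_mult:
  assumes "homogeneous w M f" "homogeneous w N g"
  shows "homogeneous w (M + N) (f * g)"
  unfolding homogeneous_def
proof (intro allI impI)
  fix m assume "mfps_coeff (f * g) m \<noteq> 0"
  then obtain p where "p \<in> splits m" "(case p of (a, b) \<Rightarrow> mfps_coeff f a * mfps_coeff g b) \<noteq> 0"
    unfolding mfps_coeff_mult by (rule sum.not_neutral_contains_not_neutral)
  then show "wdeg w m = M + N"
    using assms by (cases p) (auto simp: homogeneous_def splits_def wdeg_add dest!: mult_not_zero)
qed

lemma homogeneous_sum: "(\<And>x. x \<in> S \<Longrightarrow> homogeneous w N (F x)) \<Longrightarrow> homogeneous w N (sum F S)"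
  unfolding homogeneous_def mfps_coeff_sum by (metis (mono_tags, lifting) sum.neutral)

lemma homogeneous_prod:
  "(\<And>x. x \<in> S \<Longrightarrow> homogeneous w (d x) (F x)) \<Longrightarrow> homogeneous w (sum d S) (prod F S)"
  by (induction S rule: infinite_finite_induct) (auto simp: homogeneous_1 homogeneous_mult)

lemma homogeneous_power:
  assumes "homogeneous w N f"
  shows "homogeneous w (k * N) (f ^ k)"
  by (induction k) (simp_all add: homogeneous_1 homogeneous_mult assms)

lemma homogeneous_const_mult: "homogeneous w N f \<Longrightarrow> homogeneous w N (mfps_const c * f)"
  by (auto simp: homogeneous_def dest!: mult_not_zero)

lemma homogeneous_matpow:
  assumes "\<And>i j. homogeneous w 1 (A $ i $ j)"
  shows "homogeneous w t (matpow A t $ i $ j)"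
proof (induction t arbitrary: i j)
  case (Suc t)
  have "homogeneous w (1 + t) (A $ i $ k * matpow A t $ k $ j)" for k
    by (intro homogeneous_mult assms Suc)
  then show ?case
    by (simp add: matrix_matrix_mult_def homogeneous_sum)
qed (simp add: mat_def homogeneous_1)

lemma homogeneous_trace_matpow:
  assumes "\<And>i j. homogeneous w 1 (A $ i $ j)"
  shows "homogeneous w t (trace (matpow A t))"
  unfolding trace_def by (intro homogeneous_sum homogeneous_matpow assms)

lemma homogeneous_dperm:
  assumes "homogeneous w 0 \<beta>" "\<And>x y. homogeneous w 1 (M x y)"
  shows "homogeneous w (card X) (dperm \<beta> X M)"
  unfolding dperm_def
proof (rule homogeneous_sum)
  fix \<pi>
  have "homogeneous w (num_cycles X \<pi> * 0 + (\<Sum>x\<in>X. 1))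
      (\<beta> ^ num_cycles X \<pi> * (\<Prod>x\<in>X. M x (\<pi> x)))"
    by (intro homogeneous_mult homogeneous_power homogeneous_prod assms)
  then show "homogeneous w (card X) (\<beta> ^ num_cycles X \<pi> * (\<Prod>x\<in>X. M x (\<pi> x)))"
    by simp
qed

section \<open>Exponentials and the Euler operator\<close>

text \<open>The Euler derivation for the weighted degree.\<close>

definition euler :: "('v \<Rightarrow> nat) \<Rightarrow> ('v, 'a::comm_ring_1) mfps \<Rightarrow> ('v, 'a) mfps" where
  "euler w f = Abs_mfps (\<lambda>m. of_nat (wdeg w m) * mfps_coeff f m)"

lemma mfps_coeff_euler [simp]: "mfps_coeff (euler w f) m = of_nat (wdeg w m) * mfps_coeff f m"
  by (simp add: euler_def)

lemma hpart_euler: "hpart w N (euler w f) = of_nat N * hpart w N f"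
  by (rule mfps_eqI) simp

lemma euler_mult: "euler w (f * g) = euler w f * g + f * euler w g"
proof (rule mfps_eqI)
  fix m
  have "(\<Sum>(a, b)\<in>splits m. of_nat (wdeg w m) * (mfps_coeff f a * mfps_coeff g b))
      = (\<Sum>(a, b)\<in>splits m. of_nat (wdeg w a) * mfps_coeff f a * mfps_coeff g b
          + mfps_coeff f a * (of_nat (wdeg w b) * mfps_coeff g b))"
    by (intro sum.cong) (auto simp: splits_def wdeg_add algebra_simps)
  then show "mfps_coeff (euler w (f * g)) m = mfps_coeff (euler w f * g + f * euler w g) m"
    by (simp add: mfps_coeff_mult sum_distrib_left case_prod_unfold sum.distrib)
qed

lemma euler_1: "euler w 1 = 0"
  by (rule mfps_eqI) (simp add: mfps_coeff_1)

lemma euler_power_Suc: "euler w (f ^ Suc k) = of_nat (Suc k) * (euler w f * f ^ k)"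
proof (induction k)
  case (Suc k)
  have "euler w (f ^ Suc (Suc k)) = euler w f * f ^ Suc k + f * euler w (f ^ Suc k)"
    by (simp add: euler_mult)
  then show ?case
    unfolding Suc by (simp add: algebra_simps)
qed (simp add: euler_1)

text \<open>Below a given degree the exponential is a polynomial in \<open>f\<close>, so that identities for it reduce to
  finite sums.\<close>

lemma mfps_coeff_exp:
  fixes f :: "('v, 'a::field_char_0) mfps"
  assumes "mfps_coeff f 0 = 0" "monom_deg m \<le> K"
  shows "mfps_coeff (mfps_exp f) m = mfps_coeff (\<Sum>k\<le>K. mfps_const (1 / fact k) * f ^ k) m"
proof -
  have "order_ge k (f ^ k)" for k
    using assms(1) by (intro order_ge_power) (simp only: order_ge_1_iff)
  then have "mfps_coeff (f ^ k) m = 0" if "k > K" for k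
    using that assms(2) by (auto simp: order_ge_def)
  then have "{k. mfps_coeff (mfps_const (1 / fact k) * f ^ k) m \<noteq> 0} \<subseteq> {..K}"
    by (auto simp: not_less[symmetric])
  then show ?thesis
    unfolding mfps_exp_def formal_sum_def mfps_coeff_Abs mfps_coeff_sum
    by (intro sum.mono_neutral_left) auto
qed

lemma monom_deg_splits: "(a, b) \<in> splits m \<Longrightarrow> monom_deg b \<le> monom_deg m"
  by (auto simp: splits_def monom_deg_add)

text \<open>The Euler operator multiplies \<open>f ^ k / k!\<close> into \<open>euler w f * f ^ (k - 1) / (k - 1)!\<close>. The partial sum
  for the left side needs one term more than the one for the right.\<close>

lemma euler_exp:
  fixes f :: "('v, 'a::field_char_0) mfps"
  assumes "mfps_coeff f 0 = 0"
  shows "euler w (mfps_exp f) = euler w f * mfps_exp f"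
proof (rule mfps_eqI)
  fix m :: "'v \<Rightarrow>\<^sub>0 nat"
  let ?e = "\<lambda>K. \<Sum>k\<le>K. mfps_const (1 / fact k) * f ^ k"
  let ?K = "monom_deg m"
  have coeff_Suc: "of_nat (wdeg w m) * mfps_coeff (mfps_const (1 / fact (Suc k)) * f ^ Suc k) m
      = mfps_coeff (euler w f * (mfps_const (1 / fact k) * f ^ k)) m" for k
  proof -
    have "of_nat (wdeg w m) * mfps_coeff (mfps_const (1 / fact (Suc k)) * f ^ Suc k) m
        = 1 / fact (Suc k) * mfps_coeff (euler w (f ^ Suc k)) m"
      by (simp only: mfps_coeff_const_mult mfps_coeff_euler) (simp only: mult_ac)
    also have "\<dots> = 1 / fact k * mfps_coeff (euler w f * f ^ k) m"
      unfolding euler_power_Suc mfps_coeff_of_nat_mult by (simp del: of_nat_Suc)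
    also have "\<dots> = mfps_coeff (euler w f * (mfps_const (1 / fact k) * f ^ k)) m"
      by (simp only: mult.left_commute[of _ "mfps_const _"] mfps_coeff_const_mult)
    finally show ?thesis .
  qed
  have "mfps_coeff (euler w (mfps_exp f)) m = of_nat (wdeg w m) * mfps_coeff (?e (Suc ?K)) m"
    using mfps_coeff_exp[OF assms, of m "Suc ?K"] by simp
  also have "\<dots> = of_nat (wdeg w m) * mfps_coeff 1 m + mfps_coeff (euler w f * ?e ?K) m"
    unfolding sum.atMost_Suc_shift mfps_coeff_add mfps_coeff_sum distrib_left sum_distrib_left coeff_Suc
    by simp
  also have "of_nat (wdeg w m) * mfps_coeff 1 m = (0 :: 'a)"
    by (simp add: mfps_coeff_1)
  also have "mfps_coeff (euler w f * ?e ?K) m = mfps_coeff (euler w f * mfps_exp f) m"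
    unfolding mfps_coeff_mult
    by (intro sum.cong refl)
       (auto dest: monom_deg_splits simp: mfps_coeff_exp[OF assms, symmetric] simp del: mfps_coeff_sum)
  finally show "mfps_coeff (euler w (mfps_exp f)) m = mfps_coeff (euler w f * mfps_exp f) m"
    by simp
qed

lemma hpart_0_exp:
  fixes f :: "('v, 'a::field_char_0) mfps"
  assumes "mfps_coeff f 0 = 0" "hpart w 0 f = 0"
  shows "hpart w 0 (mfps_exp f) = 1"
proof -
  have "hpart w 0 (f ^ Suc k) = 0" for k
    using assms(2) by (simp add: hpart_mult)
  then have "mfps_coeff (f ^ Suc k) m = 0" if "wdeg w m = 0" for k m
    using that by (metis mfps_coeff_hpart mfps_coeff_0)
  then have "mfps_coeff (mfps_exp f) m = mfps_coeff 1 m" if "wdeg w m = 0" for m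
    unfolding mfps_coeff_exp[OF assms(1) le_SucI[OF order.refl]] sum.atMost_Suc_shift
    using that by (simp del: power_Suc)
  then show ?thesis
    by (auto intro!: mfps_eqI simp: mfps_coeff_1)
qed

text \<open>The trace of \<open>A\<^sup>t\<close> is homogeneous of degree \<open>t\<close>, so each part picks out a single term.\<close>

lemma hpart_log_det:
  fixes A :: "('v, 'a::field_char_0) mfps ^ 'n ^ 'n"
  assumes "\<And>i j. homogeneous w 1 (A $ i $ j)"
  shows "hpart w N (formal_sum (\<lambda>t. mfps_const (1 / of_nat t) * trace (matpow A t)) {1..})
    = (if N = 0 then 0 else mfps_const (1 / of_nat N) * trace (matpow A N))"
proof (rule mfps_eqI)
  fix m
  let ?F = "\<lambda>t. mfps_const (1 / of_nat t) * trace (matpow A t)"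
  define c where "c t = mfps_coeff (?F t) m" for t
  have c: "c t = 0" if "wdeg w m \<noteq> t" for t
    using homogeneous_trace_matpow[OF assms, of t] that by (auto simp: c_def homogeneous_def)
  have "mfps_coeff (formal_sum ?F {1..}) m = (\<Sum>t | t \<in> {1..} \<and> c t \<noteq> 0. c t)"
    by (simp only: formal_sum_def mfps_coeff_Abs c_def)
  also have "\<dots> = (\<Sum>t\<in>{1..} \<inter> {wdeg w m}. c t)"
  proof (rule sum.mono_neutral_left)
    show "{t. t \<in> {1..} \<and> c t \<noteq> 0} \<subseteq> {1..} \<inter> {wdeg w m}"
    proof
      fix t assume "t \<in> {t. t \<in> {1..} \<and> c t \<noteq> 0}"
      then show "t \<in> {1..} \<inter> {wdeg w m}"
        using c[of t] by (cases "wdeg w m = t") auto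
    qed
  qed auto
  finally have "mfps_coeff (formal_sum ?F {1..}) m = (if wdeg w m = 0 then 0 else c (wdeg w m))"
    by auto
  then have "mfps_coeff (hpart w N (formal_sum ?F {1..})) m = (if N = 0 then 0 else c N)"
    using c[of N] by (simp only: mfps_coeff_hpart) auto
  then show "mfps_coeff (hpart w N (formal_sum ?F {1..})) m
      = mfps_coeff (if N = 0 then 0 else ?F N) m"
    by (simp only: c_def if_distrib[of "\<lambda>f. mfps_coeff f m"] mfps_coeff_0)
qed

section \<open>Comparison of the two sides\<close>

text \<open>With \<open>\<theta>\<close> the Euler operator, \<open>\<theta> E = G E\<close> for
  \<open>G = \<theta> (- \<beta> Tr A + \<beta> (\<Sum>t\<ge>1. Tr (A\<^sup>t) / t)) = \<beta> (\<Sum>t\<ge>2. Tr (A\<^sup>t))\<close>: the operator cancels the denominators,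
  and the factor \<open>exp (- \<beta> Tr A)\<close> removes exactly the term with \<open>t = 1\<close>. The recursion is the homogeneous
  part of this equation.\<close>

lemma hpart_exp_times_det:
  fixes A :: "('v, 'a::field_char_0) mfps ^ 'n ^ 'n" and \<beta> :: "('v, 'a) mfps"
  assumes A: "\<And>i j. homogeneous w 1 (A $ i $ j)" and \<beta>: "homogeneous w 0 \<beta>"
  defines "E \<equiv> mfps_exp (- (\<beta> * trace A)) * det_I_minus_powr_uminus A \<beta>"
  shows "hpart w 0 E = 1" and "hpart w 1 E = 0"
    and "of_nat (Suc (Suc N)) * hpart w (Suc (Suc N)) E
      = \<beta> * (\<Sum>s\<le>N. trace (matpow A (Suc (Suc s))) * hpart w (N - s) E)"
proof -
  define L where "L = formal_sum (\<lambda>t. mfps_const (1 / of_nat t) * trace (matpow A t)) {1..}"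
  define f where "f = - (\<beta> * trace A)"
  define g where "g = \<beta> * L"
  have E: "E = mfps_exp f * mfps_exp g"
    by (simp add: E_def f_def g_def L_def det_I_minus_powr_uminus_def)
  have \<beta>': "hpart w t \<beta> = (if t = 0 then \<beta> else 0)" for t
    using hpart_homogeneous[OF \<beta>] .
  have f: "hpart w N f = (if N = 1 then f else 0)" for N
  proof -
    have "homogeneous w 1 (trace A)"
      unfolding trace_def by (intro homogeneous_sum A)
    then have "homogeneous w 1 (\<beta> * trace A)"
      using homogeneous_mult[OF \<beta>] by fastforce
    then have "homogeneous w 1 f"
      by (simp add: f_def homogeneous_def)
    then show ?thesis
      by (rule hpart_homogeneous)
  qed
  have g: "hpart w N g = \<beta> * (if N = 0 then 0 else mfps_const (1 / of_nat N) * trace (matpow A N))" for N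
  proof -
    have "hpart w N g = (\<Sum>t\<le>N. if t = 0 then \<beta> * hpart w (N - 0) L else 0)"
      unfolding g_def hpart_mult by (intro sum.cong) (auto simp: \<beta>')
    then have "hpart w N g = \<beta> * hpart w N L"
      by simp
    then show ?thesis
      unfolding L_def hpart_log_det[OF A] .
  qed
  have "mfps_coeff (hpart w 0 f) 0 = 0" "mfps_coeff (hpart w 0 g) 0 = 0"
    unfolding f g by simp_all
  then have f0: "mfps_coeff f 0 = 0" and g0: "mfps_coeff g 0 = 0"
    by simp_all
  have "hpart w 0 E = hpart w 0 (mfps_exp f) * hpart w 0 (mfps_exp g)"
    by (simp add: E hpart_mult)
  then show "hpart w 0 E = 1"
    using f[of 0] g[of 0] by (simp add: hpart_0_exp f0 g0)
  define G where "G = euler w f + euler w g"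
  have "euler w E = G * E"
    by (simp add: E G_def euler_mult euler_exp f0 g0 algebra_simps)
  then have rec: "of_nat N * hpart w N E = (\<Sum>t\<le>N. hpart w t G * hpart w (N - t) E)" for N
    by (metis hpart_euler hpart_mult)
  have G: "hpart w t G = of_nat t * hpart w t f + of_nat t * hpart w t g" for t
    by (rule mfps_eqI) (simp add: G_def)
  have G0: "hpart w 0 G = 0"
    by (simp add: G)
  have G1: "hpart w 1 G = 0"
  proof -
    have "mfps_const (1 / of_nat 1) * trace (matpow A 1) = trace A"
      by (rule mfps_eqI) simp
    then show ?thesis
      unfolding G f g by (simp add: f_def)
  qed
  have G2: "hpart w (Suc (Suc s)) G = \<beta> * trace (matpow A (Suc (Suc s)))" for s
  proof -
    have "of_nat n * (\<beta> * (mfps_const (1 / of_nat n) * h)) = \<beta> * h" if "n > 0" for n and h :: "('v, 'a) mfps"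
    proof -
      have "of_nat n * (mfps_const (1 / of_nat n) * h) = h"
        using that by (intro mfps_eqI) simp
      then show ?thesis
        by (metis mult.left_commute)
    qed
    then show ?thesis
      unfolding G f g by (simp del: of_nat_Suc matpow.simps)
  qed
  show "hpart w 1 E = 0"
    using rec[of 1] G0 G1 by simp
  show "of_nat (Suc (Suc N)) * hpart w (Suc (Suc N)) E
      = \<beta> * (\<Sum>s\<le>N. trace (matpow A (Suc (Suc s))) * hpart w (N - s) E)"
    unfolding rec sum.atMost_Suc_shift using G0 G1
    by (simp add: G2 sum_distrib_left mult.assoc del: matpow.simps)
qed

lemma of_nat_mult_left_cancel_mfps:
  fixes f g :: "('v, 'a::field_char_0) mfps"
  assumes "of_nat (Suc n) * f = of_nat (Suc n) * g"
  shows "f = g"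
  using assms by (simp add: mfps_eq_iff del: of_nat_Suc)

lemma dperm_part_eq_hpart:
  fixes A :: "('v, 'a::field_char_0) mfps ^ 'n::finite ^ 'n" and \<beta> :: "('v, 'a) mfps"
  assumes "\<And>i j. homogeneous w 1 (A $ i $ j)" "homogeneous w 0 \<beta>"
  shows "dperm_part \<beta> A N = hpart w N (mfps_exp (- (\<beta> * trace A)) * det_I_minus_powr_uminus A \<beta>)"
proof (induction N rule: less_induct)
  case (less N)
  note E = hpart_exp_times_det[of w A \<beta>, OF assms]
  consider "N = 0" | "N = 1" | M where "N = Suc (Suc M)"
    by (metis One_nat_def not0_implies_Suc)
  then show ?case
  proof cases
    case 3
    show ?thesis
      unfolding 3
      by (rule of_nat_mult_left_cancel_mfps[of "Suc M"])
         (simp only: dperm_part_rec E, intro arg_cong2[where f = "(*)"] sum.cong refl less, simp add: 3)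
  qed (simp_all only: dperm_part_0 dperm_part_rec E)
qed

theorem theorem6p1:
  fixes \<beta> :: "('n::finite indet, rat) mfps"
    and A :: "('n indet, rat) mfps ^ 'n ^ 'n"
  assumes "\<beta> = mfps_var Beta_indet"
    and "\<And>i j. A $ i $ j = mfps_var (Entry_indet i j)"
  shows "has_formal_sum
           (\<lambda>r :: nat ^ 'n. mfps_const (1 / (\<Prod>i\<in>UNIV. fact (r $ i))) *
              dperm \<beta> (multiset_index r) (repeated_matrix A))
           (mfps_exp (- (\<beta> * trace A)) * det_I_minus_powr_uminus A \<beta>)
           UNIV"
proof -
  \<comment> \<open>The degree in the matrix entries alone, so that a term for \<open>r\<close> has degree \<open>\<Sum>i. r\<^sub>i\<close>, whatever its
    power of \<open>\<beta>\<close>.\<close>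
  define w where "w = case_indet 0 (\<lambda>(i :: 'n) (j :: 'n). 1 :: nat)"
  let ?F = "\<lambda>r :: nat ^ 'n. mfps_const (1 / (\<Prod>i\<in>UNIV. fact (r $ i))) *
    dperm \<beta> (multiset_index r) (repeated_matrix A)"
  let ?E = "mfps_exp (- (\<beta> * trace A)) * det_I_minus_powr_uminus A \<beta>"
  have A: "homogeneous w 1 (A $ i $ j)" for i j
    using homogeneous_var[of w "Entry_indet i j"] by (simp add: assms(2) w_def)
  have \<beta>: "homogeneous w 0 \<beta>"
    using homogeneous_var[of w Beta_indet] by (simp add: assms(1) w_def)
  have "homogeneous w (\<Sum>i\<in>UNIV. r $ i) (?F r)" for r
    unfolding card_multiset_index[symmetric]
    by (intro homogeneous_const_mult homogeneous_dperm \<beta>) (simp only: repeated_matrix_def A case_prod_unfold)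
  then have supp: "{r \<in> UNIV. mfps_coeff (?F r) m \<noteq> 0} \<subseteq> vecs_of_sum (wdeg w m)" for m
    by (auto simp: homogeneous_def vecs_of_sum_def)
  have "formally_summable ?F UNIV"
    unfolding formally_summable_def using supp finite_vecs_of_sum by (meson finite_subset)
  moreover have "formal_sum ?F UNIV = ?E"
  proof (rule mfps_eqI)
    fix m
    have "mfps_coeff (formal_sum ?F UNIV) m = (\<Sum>r\<in>vecs_of_sum (wdeg w m). mfps_coeff (?F r) m)"
      unfolding formal_sum_def mfps_coeff_Abs by (rule sum.mono_neutral_left) (use supp in auto)
    also have "\<dots> = mfps_coeff (dperm_part \<beta> A (wdeg w m)) m"
      by (simp add: dperm_part_def egf_part_def)
    also have "\<dots> = mfps_coeff ?E m"
      by (simp add: dperm_part_eq_hpart[OF A \<beta>])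
    finally show "mfps_coeff (formal_sum ?F UNIV) m = mfps_coeff ?E m" .
  qed
  ultimately show ?thesis
    by (simp add: has_formal_sum_def)
qed

end
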